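(* Let $n\geq 2$, let $a\in\mathbb{B}^n$, and let $f:\mathbb{B}^n\setminus\{0\}\to\mathbb{B}^n\setminus\{a\}$ be a Möbius map from $\mathbb{B}^n\setminus\{0\}$ onto $\mathbb{B}^n\setminus\{a\}$ with $f(0)=a$. Then for all $x,y\in\mathbb{B}^n\setminus\{0\}$, $$\chi_0(x,y)\leq\chi_a(f(x),f(y))\leq\chi_0(x,y)-\log(1-|a|^2).$$ The equalities (both of them) hold if and only if $a=0$.
   Context: $|x-y|$ denotes the Euclidean distance in $\mathbb{R}^n$ and $\mathbb{B}^n=\{x\in\mathbb{R}^n:|x|<1\}$ is the open unit ball. For $p\in\mathbb{R}^n$ and $x,y\in\mathbb{R}^n\setminus\{p\}$, $$\chi_p(x,y)=\log\left(1+\frac{|x-y|}{|x-p|\,|y-p|}\right).$$ A Möbius map is (the restriction of) a Möbius transformation of $\mathbb{R}^n\cup\{\infty\}$, i.e. a finite composition of inversions in spheres and reflections in hyperplanes; orientation-reversing maps are allowed. The condition $f(0)=a$ refers to the value at $0$ of the Möbius transformation of which $f$ is the restriction. *)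

theory Defs
  imports "HOL-Analysis.Analysis"
begin

(* Junk value for x = p or y = p (division by zero); only meaningful away from p. *)
definition chi :: "'a::euclidean_space \<Rightarrow> 'a \<Rightarrow> 'a \<Rightarrow> real" where
  "chi p x y = ln (1 + dist x y / (dist x p * dist y p))"

(* The extended space is rendered as 'a option, with None as the point at infinity,
   matching the convention of Alexandroff_compactification. *)

(* Inversion in the sphere with centre c and radius r, exchanging c and infinity. *)
definition sphere_inversion ::
    "'a::euclidean_space \<Rightarrow> real \<Rightarrow> 'a option \<Rightarrow> 'a option" where
  "sphere_inversion c r z =
     (case z of
        None \<Rightarrow> Some c
      | Some x \<Rightarrow> if x = c then None
                  else Some (c + (r / dist x c)\<^sup>2 *\<^sub>R (x - c)))"

(* Reflection in the hyperplane {x. u \<bullet> x = t}, for u \<noteq> 0 not necessarily a unit vector. *)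
definition hyperplane_reflection ::
    "'a::euclidean_space \<Rightarrow> real \<Rightarrow> 'a option \<Rightarrow> 'a option" where
  "hyperplane_reflection u t =
     map_option (\<lambda>x. x - (2 * (u \<bullet> x - t) / (u \<bullet> u)) *\<^sub>R u)"

inductive_set moebius_transformations ::
    "('a::euclidean_space option \<Rightarrow> 'a option) set" where
  identity: "id \<in> moebius_transformations"
| inversion: "\<lbrakk>r > 0; g \<in> moebius_transformations\<rbrakk>
    \<Longrightarrow> sphere_inversion c r \<circ> g \<in> moebius_transformations"
| reflection: "\<lbrakk>u \<noteq> 0; g \<in> moebius_transformations\<rbrakk>
    \<Longrightarrow> hyperplane_reflection u t \<circ> g \<in> moebius_transformations"

end

theory Submission
  imports Defs
begin

text \<open>
  A Moebius transformation \<open>F\<close> distorts distances by a product of two weights: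
  \<open>\<bar>F x - F y\<bar> = w x * w y * \<bar>x - y\<bar>\<close> for a positive function \<open>w\<close>, whose square is the local
  dilation of \<open>F\<close>. In the quotient \<open>\<bar>F x - F y\<bar> / (\<bar>F x - F 0\<bar> * \<bar>F y - F 0\<bar>)\<close> the weights at \<open>x\<close> and
  \<open>y\<close> cancel, so that it equals \<open>T / (w 0)\<^sup>2\<close> with \<open>T = \<bar>x - y\<bar> / (\<bar>x\<bar> * \<bar>y\<bar>)\<close>.

  If \<open>F\<close> maps the unit ball onto itself and \<open>0\<close> to \<open>a\<close>, then \<open>(w 0)\<^sup>2 = 1 - \<bar>a\<bar>\<^sup>2\<close>
  (\<open>weight_at_origin\<close>). With \<open>c = 1 - \<bar>a\<bar>\<^sup>2\<close>, which lies in the interval from \<open>0\<close> to \<open>1\<close> and is \<open>1\<close>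
  exactly for \<open>a = 0\<close>, the three quantities to be compared are the logarithms of \<open>1 + T\<close>,
  \<open>1 + T / c\<close> and \<open>(1 + T) / c\<close>, and everything follows by inspection.

  The weights exist because they multiply along compositions, provided that infinity is included
  through a suitable extension of the distance (\<open>ext_dist\<close>), so only single inversions and
  reflections have to be computed (\<open>moebius_distorts\<close>). The extended law also determines the shape
  of \<open>F\<close>: either \<open>F\<close> fixes infinity and \<open>w\<close> is constant on finite points, or \<open>F\<close> has a finite pole
  \<open>p\<close> and \<open>w x\<close> is proportional to \<open>1 / \<bar>x - p\<bar>\<close>. In each case the remaining constants are found by
  comparing the largest and the smallest distance of points of the ball from \<open>p\<close>, from \<open>F \<infinity>\<close> and
  from \<open>a\<close> before and after applying \<open>F\<close>.
\<close>

section \<open>The weight of a transformation\<close>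

text \<open>
  This is the chordal distance \<open>2 * \<bar>x - y\<bar> / (sqrt (1 + \<bar>x\<bar>\<^sup>2) * sqrt (1 + \<bar>y\<bar>\<^sup>2))\<close>, whose value between
  \<open>x\<close> and infinity is \<open>2 / sqrt (1 + \<bar>x\<bar>\<^sup>2)\<close>, without the constant \<open>2\<close> and without the factor
  \<open>1 / sqrt (1 + \<bar>x\<bar>\<^sup>2)\<close> that each finite point contributes. It is no longer a metric, but the omitted
  factors can be absorbed by weights, so a product law for the one distance is a product law for
  the other.
\<close>

definition ext_dist :: "'a::euclidean_space option \<Rightarrow> 'a option \<Rightarrow> real" where
  "ext_dist z z' =
     (case z of
        None \<Rightarrow> (case z' of None \<Rightarrow> 0 | Some y \<Rightarrow> 1)
      | Some x \<Rightarrow> (case z' of None \<Rightarrow> 1 | Some y \<Rightarrow> dist x y))"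

lemma ext_dist_simps [simp]:
  "ext_dist None None = 0" "ext_dist None (Some y) = 1"
  "ext_dist (Some x) None = 1" "ext_dist (Some x) (Some y) = dist x y"
  by (simp_all add: ext_dist_def)

definition distorts_by :: "('a::euclidean_space option \<Rightarrow> 'a option) \<Rightarrow> ('a option \<Rightarrow> real) \<Rightarrow> bool" where
  "distorts_by F w \<longleftrightarrow>
     (\<forall>z. w z > 0) \<and> (\<forall>z z'. ext_dist (F z) (F z') = w z * w z' * ext_dist z z')"

lemma distorts_byD:
  assumes "distorts_by F w"
  shows "w z > 0" "ext_dist (F z) (F z') = w z * w z' * ext_dist z z'"
  using assms by (auto simp: distorts_by_def)

text \<open>The chain rule for local dilations.\<close>

lemma distorts_by_comp:
  assumes "distorts_by F w" "distorts_by G v"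
  shows "distorts_by (F \<circ> G) (\<lambda>z. w (G z) * v z)"
  using assms by (simp add: distorts_by_def)

lemma norm_diff_inversion:
  fixes u v :: "'a::real_inner"
  assumes "u \<noteq> 0" "v \<noteq> 0"
  shows "norm ((r / norm u)\<^sup>2 *\<^sub>R u - (r / norm v)\<^sup>2 *\<^sub>R v) = r\<^sup>2 * norm (u - v) / (norm u * norm v)"
proof (rule power2_eq_imp_eq)
  have expand: "(norm (A *\<^sub>R u - B *\<^sub>R v))\<^sup>2
      = A\<^sup>2 * (norm u)\<^sup>2 + B\<^sup>2 * (norm v)\<^sup>2 - 2 * A * B * (u \<bullet> v)" for A B
    unfolding power2_norm_eq_inner
    by (simp add: inner_diff inner_commute power2_eq_square algebra_simps)
  have "(norm ((r / norm u)\<^sup>2 *\<^sub>R u - (r / norm v)\<^sup>2 *\<^sub>R v))\<^sup>2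
      = (r / norm u)^4 * (norm u)\<^sup>2 + (r / norm v)^4 * (norm v)\<^sup>2
        - 2 * (r / norm u)\<^sup>2 * (r / norm v)\<^sup>2 * (u \<bullet> v)"
    unfolding expand by (simp add: power2_eq_square power4_eq_xxxx)
  also have "\<dots> = r^4 * ((norm u)\<^sup>2 + (norm v)\<^sup>2 - 2 * (u \<bullet> v)) / ((norm u)\<^sup>2 * (norm v)\<^sup>2)"
    using assms by (simp add: field_simps power2_eq_square power4_eq_xxxx)
  also have "(norm u)\<^sup>2 + (norm v)\<^sup>2 - 2 * (u \<bullet> v) = (norm (u - v))\<^sup>2"
    by (simp add: power2_norm_eq_inner inner_diff inner_commute)
  also have "r^4 * (norm (u - v))\<^sup>2 / ((norm u)\<^sup>2 * (norm v)\<^sup>2) = (r\<^sup>2 * norm (u - v) / (norm u * norm v))\<^sup>2"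
    by (simp add: power_divide power_mult_distrib)
  finally show "(norm ((r / norm u)\<^sup>2 *\<^sub>R u - (r / norm v)\<^sup>2 *\<^sub>R v))\<^sup>2
      = (r\<^sup>2 * norm (u - v) / (norm u * norm v))\<^sup>2" .
qed auto

text \<open>
  The weight \<open>r / \<bar>x - c\<bar>\<close> at finite \<open>x \<noteq> c\<close> forces the two exceptional ones. The image of \<open>x\<close> is at
  distance \<open>1\<close> from the image of \<open>c\<close>, which is infinity, and at distance \<open>r\<^sup>2 / \<bar>x - c\<bar>\<close> from the image of
  infinity, which is \<open>c\<close>; this gives \<open>1 / r\<close> at \<open>c\<close> and \<open>r\<close> at infinity.
\<close>

lemma sphere_inversion_distorts:
  fixes c :: "'a::euclidean_space"
  assumes "r > 0"
  shows "distorts_by (sphere_inversion c r)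
           (\<lambda>z. case z of None \<Rightarrow> r | Some x \<Rightarrow> if x = c then 1 / r else r / dist x c)"
proof -
  have main: "dist (c + (r / dist x c)\<^sup>2 *\<^sub>R (x - c)) (c + (r / dist y c)\<^sup>2 *\<^sub>R (y - c))
      = r / dist x c * (r / dist y c) * dist x y" if "x \<noteq> c" "y \<noteq> c" for x y
    using norm_diff_inversion[of "x - c" "y - c" r] that
    by (simp add: dist_norm power2_eq_square)
  show ?thesis
    unfolding distorts_by_def
    using assms main
    by (auto simp: sphere_inversion_def dist_norm power2_eq_square norm_minus_commute
        split: option.split)
qed

lemma hyperplane_reflection_distorts:
  fixes u :: "'a::euclidean_space"
  assumes "u \<noteq> 0"
  shows "distorts_by (hyperplane_reflection u t) (\<lambda>z. 1)"
proof -
  have "dist (x - (2 * (u \<bullet> x - t) / (u \<bullet> u)) *\<^sub>R u) (y - (2 * (u \<bullet> y - t) / (u \<bullet> u)) *\<^sub>R u)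
      = dist x y" for x y
  proof -
    define s where "s = 2 * (u \<bullet> (x - y)) / (u \<bullet> u)"
    have s: "s * (u \<bullet> u) = 2 * (u \<bullet> (x - y))"
      using assms by (simp add: s_def)
    have diff: "(x - (2 * (u \<bullet> x - t) / (u \<bullet> u)) *\<^sub>R u) - (y - (2 * (u \<bullet> y - t) / (u \<bullet> u)) *\<^sub>R u)
        = (x - y) - s *\<^sub>R u"
      by (simp add: s_def algebra_simps diff_divide_distrib inner_diff_right flip: scaleR_add_left scaleR_diff_left)
    have "((x - y) - s *\<^sub>R u) \<bullet> ((x - y) - s *\<^sub>R u)
        = (x - y) \<bullet> (x - y) + s * (s * (u \<bullet> u) - 2 * (u \<bullet> (x - y)))"
      by (simp add: inner_diff inner_commute algebra_simps)
    then show ?thesis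
      unfolding dist_norm diff norm_eq_sqrt_inner by (simp add: s)
  qed
  then show ?thesis
    by (auto simp: distorts_by_def hyperplane_reflection_def ext_dist_def split: option.split)
qed

lemma moebius_distorts:
  fixes F :: "'a::euclidean_space option \<Rightarrow> 'a option"
  assumes "F \<in> moebius_transformations"
  obtains w where "distorts_by F w"
proof -
  from assms have "\<exists>w. distorts_by F w"
  proof induction
    case identity
    have "distorts_by id (\<lambda>z :: 'a option. 1)"
      by (simp add: distorts_by_def)
    then show ?case by blast
  next
    case inversion
    then show ?case by (blast intro: distorts_by_comp sphere_inversion_distorts)
  next
    case reflection
    then show ?case by (blast intro: distorts_by_comp hyperplane_reflection_distorts)
  qed
  then show ?thesis using that by blast
qed

lemma sphere_inversion_invol:
  assumes "r > 0"
  shows "sphere_inversion c r (sphere_inversion c r z) = z"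
  using assms by (auto simp: sphere_inversion_def dist_norm power2_eq_square split: option.split)

lemma hyperplane_reflection_invol:
  assumes "u \<noteq> 0"
  shows "hyperplane_reflection u t (hyperplane_reflection u t z) = z"
proof (cases z)
  case (Some x)
  define s where "s = 2 * (u \<bullet> x - t) / (u \<bullet> u)"
  have "2 * (u \<bullet> (x - s *\<^sub>R u) - t) / (u \<bullet> u) = - s"
    using assms by (simp add: s_def inner_diff_right field_simps)
  then show ?thesis
    unfolding Some hyperplane_reflection_def option.map s_def[symmetric] by simp
qed (simp add: hyperplane_reflection_def)

text \<open>
  Surjectivity provides the pole, that is, a point that is sent to infinity.
\<close>

lemma moebius_surj:
  assumes "F \<in> moebius_transformations"
  shows "surj F"
  using assms
proof induction
  case identity
  show ?case by simp
next
  case inversion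
  then show ?case by (intro comp_surj) (metis sphere_inversion_invol surjI)+
next
  case reflection
  then show ?case by (intro comp_surj) (metis hyperplane_reflection_invol surjI)+
qed

section \<open>Transformations that preserve the unit ball\<close>

text \<open>
  The next two lemmas turn bounds on distances over the open ball into bounds on \<open>\<bar>c\<bar>\<close>: by continuity
  the bounds extend to the closed ball, and there the point farthest from \<open>c\<close> is \<open>- c / \<bar>c\<bar>\<close> (any unit
  vector if \<open>c = 0\<close>), while the point nearest to an outer \<open>c\<close> is \<open>c / \<bar>c\<bar>\<close>. In the second lemma, \<open>m > 0\<close>
  forces \<open>c\<close> to be an outer point.
\<close>

lemma farthest_point_unit_ball:
  fixes c :: "'a::euclidean_space"
  assumes "\<And>y. y \<in> ball 0 1 \<Longrightarrow> dist y c \<le> m"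
  shows "1 + norm c \<le> m"
proof -
  have "closure (ball 0 1) \<subseteq> cball c m"
    using assms by (intro closure_minimal) (auto simp: dist_commute)
  then have far: "dist y c \<le> m" if "norm y = 1" for y
    using that by (force simp: dist_commute)
  obtain e :: 'a where e: "norm e = 1" "c = norm c *\<^sub>R e"
  proof (cases "c = 0")
    case True
    then show ?thesis using that vector_choose_size[of 1] by (metis norm_zero scale_zero_left zero_le_one)
  next
    case False
    then show ?thesis using that[of "sgn c"] by (simp add: sgn_div_norm)
  qed
  have "- e - c = - ((1 + norm c) *\<^sub>R e)"
    using e(2) by (metis minus_add_distrib scaleR_add_left scaleR_one uminus_add_conv_diff add.commute)
  then have "dist (- e) c = 1 + norm c"
    using e(1) by (simp add: dist_norm)
  then show ?thesis
    using far[of "- e"] e(1) by simp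
qed

lemma nearest_point_unit_ball:
  fixes c :: "'a::euclidean_space"
  assumes "m > 0" and "\<And>y. y \<in> ball 0 1 \<Longrightarrow> m \<le> dist y c"
  shows "1 + m \<le> norm c"
proof -
  have "closure (ball 0 1) \<subseteq> - ball c m"
    using assms(2) by (intro closure_minimal) (force simp: dist_commute)+
  then have near: "m \<le> dist y c" if "norm y \<le> 1" for y
    using that by (force simp: dist_commute)
  have c: "norm c > 1"
    using near[of c] assms(1) by fastforce
  have "sgn c - c = (1 - norm c) *\<^sub>R sgn c"
  proof -
    have "norm c *\<^sub>R sgn c = c" using c by (cases "norm c = 0") (simp_all add: sgn_div_norm)
    then show ?thesis by (simp add: scaleR_diff_left)
  qed
  moreover have "norm (sgn c) = 1"
    using c by (auto simp: norm_sgn)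
  ultimately have "dist (sgn c) c = norm c - 1"
    using c by (simp add: dist_norm)
  then show ?thesis
    using near[of "sgn c"] \<open>norm (sgn c) = 1\<close> by simp
qed

text \<open>
  Points of the ball are at distance at most \<open>k\<close> from the centre \<open>g 0\<close>, which needs \<open>k \<ge> 1 + \<bar>g 0\<bar>\<close>. On the
  other hand, the ball has diameter \<open>2\<close>, and its image has diameter \<open>2 * k\<close>, so \<open>k \<le> 1\<close>.
\<close>

lemma similarity_of_unit_ball:
  fixes g :: "'a::euclidean_space \<Rightarrow> 'a"
  assumes k: "k > 0"
    and g: "g ` ball 0 1 = ball 0 1"
    and sim: "\<And>x y. x \<in> ball 0 1 \<Longrightarrow> y \<in> ball 0 1 \<Longrightarrow> dist (g x) (g y) = k * dist x y"
  shows "g 0 = 0" "k = 1"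
proof -
  have "1 + norm (g 0) \<le> k"
  proof (rule farthest_point_unit_ball)
    fix y :: 'a assume "y \<in> ball 0 1"
    then obtain x where x: "x \<in> ball 0 1" "y = g x" using g by blast
    then show "dist y (g 0) \<le> k"
      using sim[of x 0] k by (simp add: mult_left_le)
  qed
  moreover have "1 + norm (0 :: 'a) \<le> 1 / k"
  proof (rule farthest_point_unit_ball)
    fix x :: 'a assume x: "x \<in> ball 0 1"
    then have "g x \<in> ball 0 1" "g (- x) \<in> ball 0 1" using g by auto
    then have "dist (g x) (g (- x)) \<le> 2"
      using dist_triangle2[of "g x" "g (- x)" 0] by (simp add: dist_commute)
    moreover have "dist x (- x) = 2 * norm x"
      by (simp add: dist_norm flip: scaleR_2)
    ultimately show "dist x 0 \<le> 1 / k"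
      using sim[of x "- x"] x k by (simp add: field_simps)
  qed
  then have "k \<le> 1" using k by (simp add: field_simps)
  ultimately have "norm (g 0) \<le> 0 \<and> k = 1"
    using norm_ge_zero[of "g 0"] by linarith
  then show "g 0 = 0" "k = 1" by auto
qed

text \<open>
  Here \<open>p\<close> is the pole, \<open>q\<close> is the image of infinity, and \<open>\<bar>g x - q\<bar> * \<bar>x - p\<bar> = k\<close>. This relation is
  symmetric under exchanging \<open>g\<close> with its inverse and \<open>p\<close> with \<open>q\<close>. Over the ball, \<open>\<bar>x - p\<bar>\<close> ranges
  between \<open>\<bar>p\<bar> - 1\<close> and \<open>\<bar>p\<bar> + 1\<close>, and \<open>\<bar>g x - q\<bar>\<close> between \<open>\<bar>q\<bar> - 1\<close> and \<open>\<bar>q\<bar> + 1\<close>; as one is largest where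
  the other is smallest, \<open>k = (\<bar>p\<bar> - 1) * (\<bar>q\<bar> + 1) = (\<bar>p\<bar> + 1) * (\<bar>q\<bar> - 1)\<close>. Hence \<open>\<bar>p\<bar> = \<bar>q\<bar>\<close> and
  \<open>k = \<bar>p\<bar>\<^sup>2 - 1\<close>, so that the claim amounts to \<open>\<bar>g 0\<bar> = 1 / \<bar>p\<bar>\<close>. The image of \<open>0\<close> is at distance
  \<open>k / \<bar>p\<bar> = \<bar>p\<bar> - 1 / \<bar>p\<bar>\<close> from \<open>q\<close>, so it is not nearer to the origin than \<open>1 / \<bar>p\<bar>\<close>; and it is not
  farther either, since by \<open>centre\<close> all points of the ball are within \<open>(\<bar>p\<bar> + 1) / \<bar>p\<bar>\<close> of it.
\<close>

lemma inversion_of_unit_ball: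
  fixes g :: "'a::euclidean_space \<Rightarrow> 'a"
  assumes k: "k > 0"
    and g: "g ` ball 0 1 = ball 0 1"
    and pole: "\<And>x. x \<in> ball 0 1 \<Longrightarrow> dist (g x) q * dist x p = k"
    and centre: "\<And>x. x \<in> ball 0 1 \<Longrightarrow> dist (g x) (g 0) = k * norm x / (norm p * dist x p)"
  shows "k / (norm p)\<^sup>2 = 1 - (norm (g 0))\<^sup>2"
proof -
  \<comment> \<open>The lower bounds on distances come first: as \<open>k > 0\<close>, they put \<open>p\<close> and \<open>q\<close> outside the ball.\<close>
  have bounds: "1 + k / (1 + norm p) \<le> norm q" "1 + k / (1 + norm q) \<le> norm p"
  proof -
    have bd: "dist x c \<le> 1 + norm c" if "x \<in> ball 0 1" for x c :: 'a
      using that dist_triangle2[of x c 0] by simp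
    show "1 + k / (1 + norm p) \<le> norm q"
    proof (rule nearest_point_unit_ball)
      fix y :: 'a assume "y \<in> ball 0 1"
      then obtain x where x: "x \<in> ball 0 1" "y = g x" using g by blast
      then have "k \<le> dist y q * (1 + norm p)"
        using pole[of x] bd[of x p] mult_left_mono[of "dist x p" "1 + norm p" "dist y q"] by simp
      then show "k / (1 + norm p) \<le> dist y q"
        by (simp add: pos_divide_le_eq add_pos_nonneg)
    qed (use k in \<open>simp add: add_pos_nonneg\<close>)
    show "1 + k / (1 + norm q) \<le> norm p"
    proof (rule nearest_point_unit_ball)
      fix x :: 'a assume x: "x \<in> ball 0 1"
      then have "g x \<in> ball 0 1" using g by blast
      then have "k \<le> dist x p * (1 + norm q)"
        using pole[OF x] bd[of "g x" q] mult_right_mono[of "dist (g x) q" "1 + norm q" "dist x p"]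
        by (simp add: mult.commute)
      then show "k / (1 + norm q) \<le> dist x p"
        by (simp add: pos_divide_le_eq add_pos_nonneg)
    qed (use k in \<open>simp add: add_pos_nonneg\<close>)
  qed
  have p1: "norm p > 1" and q1: "norm q > 1"
    using bounds k by (smt (verit) divide_pos_pos norm_ge_zero)+
  have p0: "p \<noteq> 0" using p1 by auto
  have low: "norm c - 1 \<le> dist x c" if "x \<in> ball 0 1" for x c :: 'a
    using that norm_triangle_ineq2[of c x] by (simp add: dist_norm norm_minus_commute)
  have "1 + norm q \<le> k / (norm p - 1)"
  proof (rule farthest_point_unit_ball)
    fix y :: 'a assume "y \<in> ball 0 1"
    then obtain x where x: "x \<in> ball 0 1" "y = g x" using g by blast
    then have "dist y q * (norm p - 1) \<le> k"
      using pole[of x] low[of x p] mult_left_mono[of "norm p - 1" "dist x p" "dist y q"] by simp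
    then show "dist y q \<le> k / (norm p - 1)"
      using p1 by (simp add: pos_le_divide_eq)
  qed
  then have 1: "(1 + norm q) * (norm p - 1) \<le> k"
    using p1 by (simp add: pos_le_divide_eq)
  have "1 + norm p \<le> k / (norm q - 1)"
  proof (rule farthest_point_unit_ball)
    fix x :: 'a assume x: "x \<in> ball 0 1"
    then have "g x \<in> ball 0 1" using g by blast
    then have "dist x p * (norm q - 1) \<le> k"
      using pole[OF x] low[of "g x" q] mult_left_mono[of "norm q - 1" "dist (g x) q" "dist x p"]
      by (simp add: mult.commute)
    then show "dist x p \<le> k / (norm q - 1)"
      using q1 by (simp add: pos_le_divide_eq)
  qed
  then have 2: "(1 + norm p) * (norm q - 1) \<le> k"
    using q1 by (simp add: pos_le_divide_eq)
  have 3: "k \<le> (norm q - 1) * (1 + norm p)" "k \<le> (norm p - 1) * (1 + norm q)"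
  proof -
    have "k / (1 + norm p) \<le> norm q - 1" "k / (1 + norm q) \<le> norm p - 1"
      using bounds by linarith+
    moreover have "0 < 1 + norm p" "0 < 1 + norm q"
      using p1 q1 by linarith+
    ultimately show "k \<le> (norm q - 1) * (1 + norm p)" "k \<le> (norm p - 1) * (1 + norm q)"
      by (simp_all add: pos_divide_le_eq)
  qed
  have pq: "norm q = norm p"
    using 1 2 3 by (simp add: algebra_simps)
  have kp: "k = (norm p - 1) * (norm p + 1)"
    using 1 3 unfolding pq by (simp add: algebra_simps)
  have "1 + norm (g 0) \<le> (norm p + 1) / norm p"
  proof (rule farthest_point_unit_ball)
    fix y :: 'a assume "y \<in> ball 0 1"
    then obtain x where x: "x \<in> ball 0 1" "y = g x" using g by blast
    then have d: "norm p - 1 \<le> dist x p" "norm x \<le> 1" using low[of x p] by auto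
    then have "norm x * (norm p - 1) \<le> 1 * dist x p"
      using p1 by (intro mult_mono) auto
    then have "(norm p + 1) * (norm x * (norm p - 1)) \<le> (norm p + 1) * dist x p"
      by (intro mult_left_mono) (auto intro: add_nonneg_nonneg)
    moreover have "dist x p > 0" using d p1 by linarith
    ultimately have "(norm p + 1) * (norm x * (norm p - 1)) / (norm p * dist x p)
        \<le> (norm p + 1) * dist x p / (norm p * dist x p)"
      using p1 by (intro divide_right_mono) auto
    also have "\<dots> = (norm p + 1) / norm p"
      using \<open>dist x p > 0\<close> by simp
    finally show "dist y (g 0) \<le> (norm p + 1) / norm p"
      unfolding x(2) centre[OF x(1)] kp by (simp add: mult_ac)
  qed
  then have up: "norm (g 0) \<le> 1 / norm p"
    using p0 by (simp add: add_divide_distrib)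
  have "dist (g 0) q = k / norm p"
    using pole[of 0] p0 by (simp add: field_simps)
  then have "norm (g 0) \<ge> norm p - k / norm p"
    using norm_triangle_ineq2[of q "g 0"] pq by (simp add: dist_norm norm_minus_commute)
  moreover have "norm p - k / norm p = 1 / norm p"
    using p0 unfolding kp by (simp add: field_simps)
  ultimately have "norm (g 0) = 1 / norm p"
    using up by linarith
  then show ?thesis
    using p0 unfolding kp by (simp add: field_simps power2_eq_square)
qed

text \<open>
  For a Moebius self-map \<open>g\<close> of the ball, \<open>(1 - \<bar>x\<bar>\<^sup>2) * \<bar>g' x\<bar> = 1 - \<bar>g x\<bar>\<^sup>2\<close> expresses the invariance of the
  hyperbolic metric; this is the case \<open>x = 0\<close>. The two shapes of \<open>F\<close> are separated by its value at
  infinity, and its parameters are read off from the product law applied to infinity and the pole.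
\<close>

lemma weight_at_origin:
  fixes F :: "'a::euclidean_space option \<Rightarrow> 'a option"
  assumes F: "F \<in> moebius_transformations" "distorts_by F w"
    and g: "\<And>x. x \<in> ball 0 1 \<Longrightarrow> F (Some x) = Some (g x)" "g ` ball 0 1 = ball 0 1"
  shows "(w (Some 0))\<^sup>2 = 1 - (norm (g 0))\<^sup>2"
proof -
  note pos = distorts_byD(1)[OF F(2)] and dist = distorts_byD(2)[OF F(2)]
  have dg: "dist (g x) (g y) = w (Some x) * w (Some y) * dist x y"
    if "x \<in> ball 0 1" "y \<in> ball 0 1" for x y
    using dist[of "Some x" "Some y"] g(1) that by simp
  show ?thesis
  proof (cases "F None")
    case None
    have const: "w (Some x) = 1 / w None" if "x \<in> ball 0 1" for x
      using dist[of "Some x" None] pos[of None] None g(1)[OF that] by (simp add: field_simps)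
    have "g 0 = 0" "(1 / w None)\<^sup>2 = 1"
      using similarity_of_unit_ball[OF _ g(2), of "(1 / w None)\<^sup>2"] dg const pos[of None]
      by (auto simp: power2_eq_square)
    then show ?thesis by (simp add: const)
  next
    case q: (Some q)
    obtain z where z: "F z = None" using moebius_surj[OF F(1)] by (metis surjD)
    with q obtain p where p: "F (Some p) = None" by (cases z) auto
    have inv: "w (Some p) * w None = 1"
      using dist[of "Some p" None] p q by simp
    have pole: "w (Some x) * dist x p = w None" "dist (g x) q = w (Some x) * w None"
      if "x \<in> ball 0 1" for x
    proof -
      have "w (Some x) * dist x p * w (Some p) = 1"
        using dist[of "Some x" "Some p"] p g(1)[OF that] by (simp add: mult_ac)
      then show "w (Some x) * dist x p = w None"
        using inv pos[of "Some p"] by (metis mult.commute mult_right_cancel less_irrefl)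
      show "dist (g x) q = w (Some x) * w None"
        using dist[of "Some x" None] q g(1)[OF that] by simp
    qed
    have nz: "dist x p \<noteq> 0" if "x \<in> ball 0 1" for x
      using g(1)[OF that] p by auto
    have w: "w (Some x) = w None / dist x p" if "x \<in> ball 0 1" for x
      using pole(1)[OF that] nz[OF that] by (simp add: field_simps)
    have "(w None)\<^sup>2 / (norm p)\<^sup>2 = 1 - (norm (g 0))\<^sup>2"
    proof (rule inversion_of_unit_ball)
      show "dist (g x) q * dist x p = (w None)\<^sup>2" if "x \<in> ball 0 1" for x
        using pole[OF that] by (simp add: power2_eq_square mult_ac)
      show "dist (g x) (g 0) = (w None)\<^sup>2 * norm x / (norm p * dist x p)" if "x \<in> ball 0 1" for x
        using dg[OF that, of 0] w[OF that] w[of 0] by (simp add: power2_eq_square mult_ac)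
    qed (use pos[of None] g(2) in auto)
    then show ?thesis using w[of 0] by (simp add: power_divide)
  qed
qed

section \<open>Comparison of the two metrics\<close>

theorem theorem8:
  fixes a :: "real ^ 'n"
    and f :: "real ^ 'n \<Rightarrow> real ^ 'n"
    and F :: "(real ^ 'n) option \<Rightarrow> (real ^ 'n) option"
  assumes "CARD('n) \<ge> 2"
    and "a \<in> ball 0 1"
    and "F \<in> moebius_transformations"
    and "\<forall>x \<in> ball 0 1 - {0}. F (Some x) = Some (f x)"
    and "F (Some 0) = Some a"
    and "f ` (ball 0 1 - {0}) = ball 0 1 - {a}"
  shows "\<forall>x \<in> ball 0 1 - {0}. \<forall>y \<in> ball 0 1 - {0}.
           chi 0 x y \<le> chi a (f x) (f y) \<and>
           chi a (f x) (f y) \<le> chi 0 x y - ln (1 - (norm a)\<^sup>2) \<and>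
           (x \<noteq> y \<longrightarrow> (chi 0 x y = chi a (f x) (f y) \<longleftrightarrow> a = 0)) \<and>
           (chi a (f x) (f y) = chi 0 x y - ln (1 - (norm a)\<^sup>2) \<longleftrightarrow> a = 0)"
proof -
  obtain w where w: "distorts_by F w"
    using moebius_distorts[OF assms(3)] .
  note pos = distorts_byD(1)[OF w] and dist = distorts_byD(2)[OF w]
  define c where "c = 1 - (norm a)\<^sup>2"
  have c: "0 < c" "c \<le> 1" "c = 1 \<longleftrightarrow> a = 0"
    using assms(2) by (auto simp: c_def power_less_one_iff abs_square_less_1)
  have w0: "(w (Some 0))\<^sup>2 = c"
  proof -
    have "(w (Some 0))\<^sup>2 = 1 - (norm ((f(0 := a)) 0))\<^sup>2"
    proof (rule weight_at_origin[OF assms(3) w, where g = "f(0 := a)"])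
      show "F (Some x) = Some ((f(0 := a)) x)" if "x \<in> ball 0 1" for x
        using that assms(4,5) by auto
      \<comment> \<open>\<open>f\<close> is arbitrary at \<open>0\<close>, so the value \<open>a\<close> of the transformation is put in there.\<close>
      have "f(0 := a) ` ball 0 1 = insert a (f ` (ball 0 1 - {0}))"
        by (auto simp: image_iff)
      then show "f(0 := a) ` ball 0 1 = ball 0 1"
        using assms(2,6) by auto
    qed
    then show ?thesis by (simp add: c_def)
  qed
  show ?thesis
  proof (intro ballI)
    fix x y :: "real ^ 'n"
    assume x: "x \<in> ball 0 1 - {0}" and y: "y \<in> ball 0 1 - {0}"
    define T where "T = dist x y / (norm x * norm y)"
    have T: "T \<ge> 0" "T = 0 \<longleftrightarrow> x = y"
      using x y by (auto simp: T_def)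
    have chi0: "chi 0 x y = ln (1 + T)"
      by (simp add: chi_def T_def)
    have d: "dist (f x) (f y) = w (Some x) * w (Some y) * dist x y"
      "dist (f x) a = w (Some x) * w (Some 0) * norm x"
      "dist (f y) a = w (Some y) * w (Some 0) * norm y"
      using dist[of "Some x" "Some y"] dist[of "Some x" "Some 0"] dist[of "Some y" "Some 0"]
        assms(4,5) x y by auto
    have "dist (f x) (f y) / (dist (f x) a * dist (f y) a) = T / (w (Some 0))\<^sup>2"
      unfolding d T_def using pos[of "Some x"] pos[of "Some y"] by (simp add: power2_eq_square)
    then have chia: "chi a (f x) (f y) = ln (1 + T / c)"
      by (simp add: chi_def w0)
    have chi0c: "chi 0 x y - ln (1 - (norm a)\<^sup>2) = ln ((1 + T) / c)"
      using c T chi0 by (simp add: ln_div flip: c_def)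
    have p: "0 < 1 + T" "0 < 1 + T / c" "0 < (1 + T) / c"
      using c T by (simp_all add: add_pos_nonneg)
    have "T \<le> T / c" "T = T / c \<longleftrightarrow> T = 0 \<or> c = 1"
      "1 + T / c \<le> (1 + T) / c" "1 + T / c = (1 + T) / c \<longleftrightarrow> c = 1"
      using c T by (auto simp: field_simps mult_left_le)
    then show "chi 0 x y \<le> chi a (f x) (f y) \<and>
           chi a (f x) (f y) \<le> chi 0 x y - ln (1 - (norm a)\<^sup>2) \<and>
           (x \<noteq> y \<longrightarrow> (chi 0 x y = chi a (f x) (f y) \<longleftrightarrow> a = 0)) \<and>
           (chi a (f x) (f y) = chi 0 x y - ln (1 - (norm a)\<^sup>2) \<longleftrightarrow> a = 0)"
      unfolding chi0c unfolding chi0 chia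
      using p c(3) T(2) by (simp add: ln_le_cancel_iff)
  qed
qed

end
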